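(* The number $a_{1,0}(N)$ of lattice walks in $\mathbb{Z}^2$ of length $N$, with steps in $\{(1,0),(-1,0),(0,2),(0,-1)\}$, starting at $(0,0)$, ending at $(1,0)$, and never visiting a point $(-k,0)$ with $k\ge0$ after the starting point, equals $$a_{1,0}(N)=\binom{N}{\frac{N-1}2}+\sum_{n=1}^{\lfloor N/3\rfloor}\frac{3^{3n-1}}{n\,2^{2n}}\binom{N-1}{3n-1}\binom{N-3n}{\frac{N-3n}{2}}$$ $$\qquad+\sum_{n,m,k}\frac{3^{3m+2}}{nN\,2^{2m+2}}\binom{n}{k,\,2k+1,\,n-3k-1}\binom{N-n}{3m+2}\binom{N-3m-3k-3}{\frac{N-3m-3k-4}{2}},$$ where $\binom{A}{B+1/2}$ is interpreted as $0$ for all integers $A,B$, and the second sum ranges over all $n,m,k$ such that $1\le n\le N$, $0\le m\le\frac{N-n-2}{3}$ and $0\le k\le\frac{n-1}{3}$.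
   Context: $\binom{n}{a,b,c}=\frac{n!}{a!\,b!\,c!}$ (with $a+b+c=n$) is the multinomial coefficient. The length of a walk is its number of steps.
   Formalization: The printed formula is false (at N=3 it gives 21/4, while there is exactly one walk); the proved version divides the first term by N and has lower entry (N-3n-1)/2 instead of (N-3n)/2 in the last binomial of the first sum. *)

theory Defs
  imports Complex_Main "HOL-Library.Product_Plus"
begin

definition steps :: "(int \<times> int) set" where
  "steps = {(1, 0), (-1, 0), (0, 2), (0, -1)}"

(* A walk of length N is the list of its N + 1 successive vertices. *)
definition slit_walks :: "nat \<Rightarrow> int \<times> int \<Rightarrow> (int \<times> int) list set" where
  "slit_walks N P =
    {w. length w = N + 1 \<and> w ! 0 = (0, 0) \<and> w ! N = P \<and>
        (\<forall>i<N. w ! (i + 1) - w ! i \<in> steps) \<and>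
        (\<forall>i\<in>{1..N}. \<forall>k\<ge>0. w ! i \<noteq> (-k, 0))}"

definition walk_count :: "int \<times> int \<Rightarrow> nat \<Rightarrow> nat" where
  "walk_count P N = card (slit_walks N P)"

(* The lower entry may be a half-integer, in which case the coefficient is 0. *)
definition binom :: "nat \<Rightarrow> real \<Rightarrow> real" where
  "binom A x = (if x \<in> \<nat> then real (A choose nat \<lfloor>x\<rfloor>) else 0)"

(* Used only with n = a + b + c. *)
definition multinom :: "nat \<Rightarrow> nat \<Rightarrow> nat \<Rightarrow> nat \<Rightarrow> real" where
  "multinom n a b c = fact n / (fact a * fact b * fact c)"

(* The real-valued bounds keep the ranges exact where subtraction on nat would truncate. *)
definition triples :: "nat \<Rightarrow> (nat \<times> nat \<times> nat) set" where
  "triples N =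
    {(n, m, k). 1 \<le> n \<and> n \<le> N \<and>
        real m \<le> (real N - real n - 2) / 3 \<and> real k \<le> (real n - 1) / 3}"

(* Two misprints of the printed formula for the number of walks ending at (1,0) are corrected
   in the theorem about walk_count (1, 0): its first term is divided by N, and the lower entry
   of the last binomial in the single sum is (N - 3n - 1)/2 instead of (N - 3n)/2. As printed,
   the formula gives 21/4 for N = 3, where there is exactly one walk. At N = 0 the first term
   is 0 whatever is made of the factor 1/N, because its binomial coefficient vanishes. *)

end

theory Submission
  imports Defs
begin

text \<open>
  A walk ending at \<open>(1, 0)\<close> is encoded by its word of steps. Let \<open>v\<close> be any word of \<open>N\<close> steps with sum
  \<open>(1, 0)\<close>. By the cycle lemma, for each height visited by \<open>v\<close> exactly one rotation of \<open>v\<close> starting at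
  that height avoids the slit, so \<open>N\<close> times the number of slit walks is the total number of heights
  visited by all such words. Horizontal steps do not change the set of visited heights, so this total
  is \<open>\<Sum>\<^sub>M (N choose 3M) e(M) (N - 3M choose (N - 3M - 1) / 2)\<close>, where \<open>e(M)\<close> is the total number
  of heights visited by the words of length \<open>3M\<close> over \<open>{2, -1}\<close> with sum \<open>0\<close>.

  Splitting closed words at their zeros gives \<open>3M (3M choose M) = \<Sum>\<^sub>i (3i choose i) e(M - i)\<close> with
  \<open>i < M\<close>, whose solution is determined by \<open>4 e(M + 1) = 27 e(M) + 9 C(M)\<close> and \<open>e(0) = 1\<close> with
  \<open>C(k) = (3k)! / (k! (2k + 1)!)\<close>. Unfolding this recurrence yields the first two terms of the
  formula from the power \<open>(27 / 4)\<^sup>M\<close>, and the triple sum from the remaining convolution: its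
  index \<open>n\<close> only serves to expand \<open>N choose (3m + 3k + 3)\<close> as
  \<open>\<Sum>\<^sub>n (n - 1 choose 3k) (N - n choose 3m + 2)\<close>.
\<close>

section \<open>The cycle lemma for slit walks\<close>

definition psum :: "'a::comm_monoid_add list \<Rightarrow> nat \<Rightarrow> 'a" where
  "psum xs i = sum_list (take i xs)"

definition levels :: "int list \<Rightarrow> int set" where
  "levels ys = psum ys ` {..length ys}"

definition words :: "'a::comm_monoid_add set \<Rightarrow> nat \<Rightarrow> 'a \<Rightarrow> 'a list set" where
  "words S n c = {v. set v \<subseteq> S \<and> length v = n \<and> sum_list v = c}"

text \<open>Transcribes the avoidance condition of \<open>slit_walks\<close> to words of
  steps.\<close>

definition slit :: "(int \<times> int) list \<Rightarrow> bool" where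
  "slit v \<longleftrightarrow> (\<forall>i\<in>{1..length v}. snd (psum v i) = 0 \<longrightarrow> fst (psum v i) > 0)"

lemma psum_0 [simp]: "psum xs 0 = 0"
  by (simp add: psum_def)

lemma psum_length [simp]: "psum xs (length xs) = sum_list xs"
  by (simp add: psum_def)

lemma psum_Suc: "i < length xs \<Longrightarrow> psum xs (Suc i) = psum xs i + xs ! i"
  by (simp add: psum_def take_Suc_conv_app_nth)

lemma psum_append_le: "i \<le> length xs \<Longrightarrow> psum (xs @ ys) i = psum xs i"
  by (simp add: psum_def)

lemma psum_append_add: "psum (xs @ ys) (length xs + i) = sum_list xs + psum ys i"
  by (simp add: psum_def)

lemma psum_drop:
  fixes xs :: "'a::ab_group_add list"
  assumes "i \<le> length xs"
  shows "psum (drop i xs) j = psum xs (i + j) - psum xs i"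
  using assms by (simp add: psum_def take_add)

lemma sum_list_append_comm:
  fixes xs :: "'a::comm_monoid_add list"
  shows "sum_list (xs @ ys) = sum_list (ys @ xs)"
  by (simp add: add.commute)

lemma sum_list_rotate [simp]:
  fixes xs :: "'a::comm_monoid_add list"
  shows "sum_list (rotate r xs) = sum_list xs"
  by (metis append_take_drop_id rotate_drop_take sum_list_append_comm)

text \<open>If the partial sums are continued cyclically, gaining \<open>sum_list xs\<close> per
  turn, then rotating by \<open>r\<close> shifts the index by \<open>r\<close> and subtracts the
  value at \<open>r\<close>. The second case is the one past the end of \<open>xs\<close>.\<close>

lemma psum_rotate:
  fixes xs :: "'a::ab_group_add list"
  assumes "r < length xs" "i \<le> length xs"
  shows "psum (rotate r xs) i =
    (if r + i \<le> length xs then psum xs (r + i) - psum xs r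
     else sum_list xs + psum xs (r + i - length xs) - psum xs r)"
proof (cases "r + i \<le> length xs")
  case True
  then have "psum (rotate r xs) i = psum (drop r xs) i"
    using assms by (simp add: rotate_drop_take psum_append_le)
  then show ?thesis using True assms by (simp add: psum_drop)
next
  case False
  have "psum (rotate r xs) (length (drop r xs) + (r + i - length xs))
      = sum_list (drop r xs) + psum (take r xs) (r + i - length xs)"
    using assms psum_append_add[of "drop r xs" "take r xs"]
    by (simp only: rotate_drop_take mod_less)
  moreover have "length (drop r xs) + (r + i - length xs) = i"
    using False assms by simp
  moreover have "sum_list (drop r xs) = sum_list xs - psum xs r"
    using psum_drop[of r xs "length xs - r"] assms by (simp add: psum_def)
  moreover have "psum (take r xs) (r + i - length xs) = psum xs (r + i - length xs)"
    using assms by (simp add: psum_def min_absorb1)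
  ultimately show ?thesis using False by (simp add: algebra_simps)
qed

lemma finite_words [simp]: "finite S \<Longrightarrow> finite (words S n c)"
  unfolding words_def
  by (rule finite_subset[OF _ finite_lists_length_eq[of S n]]) auto

lemma finite_steps [simp]: "finite steps"
  by (simp add: steps_def)

lemma rotate_in_words: "v \<in> words S n c \<Longrightarrow> rotate r v \<in> words S n c"
  by (simp add: words_def)

lemma inj_rotate: "inj (rotate r)"
  unfolding rotate_def by (rule inj_fn[OF inj_rotate1])

text \<open>Rotation preserves letters, length and sum, so it is an injective self-map of a finite
  set and hence a permutation of it.\<close>

lemma card_words_rotate:
  assumes "finite S"
  shows "card {v \<in> words S n c. Q (rotate r v)} = card {v \<in> words S n c. Q v}"
proof -
  have surj: "rotate r ` words S n c = words S n c"
    using assms by (intro endo_inj_surj) (auto intro: rotate_in_words inj_on_subset[OF inj_rotate])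
  have "{v \<in> words S n c. Q v} = rotate r ` {v \<in> words S n c. Q (rotate r v)}"
  proof safe
    fix v assume "v \<in> words S n c" "Q v"
    then obtain u where "u \<in> words S n c" "v = rotate r u" using surj by blast
    with \<open>Q v\<close> show "v \<in> rotate r ` {v \<in> words S n c. Q (rotate r v)}" by blast
  qed (auto intro: rotate_in_words)
  then show ?thesis
    by (simp add: card_image inj_on_subset[OF inj_rotate])
qed

lemma sum_card_swap:
  assumes "finite A" "finite B"
  shows "(\<Sum>x\<in>A. card {y \<in> B. R x y}) = (\<Sum>y\<in>B. card {x \<in> A. R x y})"
proof -
  have "(\<Sum>x\<in>A. card {y \<in> B. R x y}) = (\<Sum>x\<in>A. \<Sum>y\<in>B. if R x y then 1 else 0)"
    using assms by (simp add: sum.inter_filter[symmetric])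
  also have "\<dots> = (\<Sum>y\<in>B. \<Sum>x\<in>A. if R x y then 1 else 0)"
    by (rule sum.swap)
  also have "\<dots> = (\<Sum>y\<in>B. card {x \<in> A. R x y})"
    using assms by (simp add: sum.inter_filter[symmetric])
  finally show ?thesis .
qed

lemma fst_sum_list: "fst (sum_list xs) = sum_list (map fst xs)"
  by (induction xs) auto

lemma snd_sum_list: "snd (sum_list xs) = sum_list (map snd xs)"
  by (induction xs) auto

lemma snd_psum: "snd (psum v i) = psum (map snd v) i"
  by (simp add: psum_def take_map snd_sum_list)

lemma levels_eq_below_length:
  assumes "sum_list ys = 0" "ys \<noteq> []"
  shows "levels ys = psum ys ` {..<length ys}"
proof -
  have "{..length ys} = insert (length ys) {..<length ys}" by auto
  moreover have "psum ys (length ys) = psum ys 0" using assms by simp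
  moreover have "0 \<in> {..<length ys}" using assms by simp
  ultimately show ?thesis unfolding levels_def by (metis image_insert insert_absorb image_eqI)
qed

text \<open>The rotated walk first visits the vertices after \<open>r\<close>, then those up to
  \<open>r\<close> one turn later, translated by the total \<open>(1, 0)\<close>; hence the
  \<open>+ 1\<close> in the second condition.\<close>

lemma slit_rotate_iff:
  assumes "sum_list v = (1, 0)" "r < length v"
  shows "slit (rotate r v) \<longleftrightarrow>
    (\<forall>j\<in>{r<..length v}. snd (psum v j) = snd (psum v r) \<longrightarrow> fst (psum v r) < fst (psum v j)) \<and>
    (\<forall>j\<in>{..r}. snd (psum v j) = snd (psum v r) \<longrightarrow> fst (psum v r) < fst (psum v j) + 1)"
  (is "_ \<longleftrightarrow> ?A \<and> ?B")
proof -
  let ?N = "length v"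
  have 1: "psum (rotate r v) i = psum v (r + i) - psum v r" if "i \<le> ?N - r" for i
  proof -
    have "i \<le> ?N" "r + i \<le> ?N" using that assms(2) by linarith+
    then show ?thesis using psum_rotate[OF assms(2)] by simp
  qed
  \<comment> \<open>Both facts cover \<open>i = ?N - r\<close>, since position \<open>?N\<close> is
    position 0 one turn later.\<close>
  have 2: "psum (rotate r v) i = (1, 0) + psum v (r + i - ?N) - psum v r"
    if "?N - r \<le> i" "i \<le> ?N" for i
  proof (cases "i = ?N - r")
    case True
    then have "r + i = ?N" using assms(2) by linarith
    with that show ?thesis using psum_rotate[OF assms(2), of i] assms(1) by simp
  next
    case False
    then have "\<not> r + i \<le> ?N" using that by linarith
    with that show ?thesis using psum_rotate[OF assms(2), of i] assms(1) by simp
  qed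
  show ?thesis
  proof
    assume L: "slit (rotate r v)"
    have pos: "0 < fst (psum (rotate r v) i)"
      if "1 \<le> i" "i \<le> ?N" "snd (psum (rotate r v) i) = 0" for i
      using L that by (simp add: slit_def)
    have A: "fst (psum v r) < fst (psum v j)"
      if "r < j" "j \<le> ?N" "snd (psum v j) = snd (psum v r)" for j
    proof -
      have "psum (rotate r v) (j - r) = psum v j - psum v r"
        using 1[of "j - r"] that by simp
      then show ?thesis using pos[of "j - r"] that by simp
    qed
    have B: "fst (psum v r) < fst (psum v j) + 1"
      if "j \<le> r" "snd (psum v j) = snd (psum v r)" for j
    proof -
      have "psum (rotate r v) (j + ?N - r) = (1, 0) + psum v j - psum v r"
        using 2[of "j + ?N - r"] that assms(2) by simp
      moreover have "1 \<le> j + ?N - r" "j + ?N - r \<le> ?N" using that assms(2) by linarith+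
      ultimately show ?thesis using pos[of "j + ?N - r"] that by simp
    qed
    show "?A \<and> ?B" using A B by simp
  next
    assume R: "?A \<and> ?B"
    show "slit (rotate r v)"
      unfolding slit_def
    proof (intro ballI impI)
      fix i assume i: "i \<in> {1..length (rotate r v)}" "snd (psum (rotate r v) i) = 0"
      show "0 < fst (psum (rotate r v) i)"
      proof (cases "i \<le> ?N - r")
        case True
        then have "r + i \<in> {r<..?N}" using i(1) assms(2) by auto
        then have "snd (psum v (r + i)) = snd (psum v r) \<longrightarrow> fst (psum v r) < fst (psum v (r + i))"
          using R by blast
        then show ?thesis using i(2) by (simp add: 1[OF True])
      next
        case False
        then have j: "r + i - ?N \<in> {..r}" and "?N - r \<le> i" "i \<le> ?N" using i(1) by auto
        from j have "snd (psum v (r + i - ?N)) = snd (psum v r) \<longrightarrow>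
            fst (psum v r) < fst (psum v (r + i - ?N)) + 1"
          using R by blast
        then show ?thesis using i(2) by (simp add: 2[OF \<open>?N - r \<le> i\<close> \<open>i \<le> ?N\<close>])
      qed
    qed
  qed
qed

text \<open>Cycle lemma: among the rotations of \<open>v\<close> starting at a given visited height, only the one that
  starts at the last of the leftmost visits to this height avoids the slit.\<close>

lemma card_slit_rotations:
  assumes "sum_list v = (1, 0)"
  shows "card {r \<in> {..<length v}. slit (rotate r v)} = card (levels (map snd v))"
proof -
  let ?N = "length v" and ?h = "\<lambda>i. snd (psum v i)" and ?x = "\<lambda>i. fst (psum v i)"
  have ne: "v \<noteq> []" using assms by (auto simp: zero_prod_def)
  have s0: "sum_list (map snd v) = 0"
    using snd_psum[of v ?N] assms by (simp add: psum_def)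
  have levels: "levels (map snd v) = ?h ` {..<?N}"
    using levels_eq_below_length[OF s0] ne by (simp add: snd_psum)
  \<comment> \<open>From one admissible start to a later one at the same height the abscissa would
    have to grow, yet by less than 1, which is impossible for integers.\<close>
  have inj: "inj_on ?h {r \<in> {..<?N}. slit (rotate r v)}"
  proof (rule linorder_inj_onI')
    fix i j assume ij: "i \<in> {r \<in> {..<?N}. slit (rotate r v)}"
      "j \<in> {r \<in> {..<?N}. slit (rotate r v)}" "i < j"
    show "?h i \<noteq> ?h j"
    proof
      assume "?h i = ?h j"
      moreover have "slit (rotate i v)" "slit (rotate j v)" "i < ?N" "j < ?N" using ij by auto
      ultimately have "?x i < ?x j" "?x j < ?x i + 1"
        using ij(3) slit_rotate_iff[OF assms, of i] slit_rotate_iff[OF assms, of j]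
        by (metis greaterThanAtMost_iff less_imp_le, metis atMost_iff less_imp_le)
      then show False by simp
    qed
  qed
  have "?h ` {r \<in> {..<?N}. slit (rotate r v)} = ?h ` {..<?N}"
  proof (intro equalityI subsetI)
    fix l assume "l \<in> ?h ` {..<?N}"
    then obtain i0 where i0: "i0 < ?N" "?h i0 = l" by auto
    define S where "S = {i. i < ?N \<and> ?h i = l}"
    have S: "finite S" "S \<noteq> {}" using i0 by (auto simp: S_def)
    define mn where "mn = Min (?x ` S)"
    define i where "i = Max {i \<in> S. ?x i = mn}"
    have "mn \<in> ?x ` S" unfolding mn_def using S by (intro Min_in) auto
    then have "i \<in> {i \<in> S. ?x i = mn}" unfolding i_def using S by (intro Max_in) auto
    then have i: "i < ?N" "?h i = l" "?x i = mn" by (auto simp: S_def)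
    have min: "?x i \<le> ?x j" if "j < ?N" "?h j = l" for j
      unfolding i mn_def using that S by (intro Min_le) (auto simp: S_def)
    have max: "j \<le> i" if "j < ?N" "?h j = l" "?x j = mn" for j
      unfolding i_def using that S by (intro Max_ge) (auto simp: S_def)
    have "slit (rotate i v)"
      unfolding slit_rotate_iff[OF assms \<open>i < ?N\<close>]
    proof (intro conjI ballI impI)
      fix j assume j: "j \<in> {i<..?N}" "?h j = ?h i"
      show "?x i < ?x j"
      proof (cases "j = ?N")
        \<comment> \<open>The endpoint \<open>(1, 0)\<close> has the height of the start, whose
          abscissa 0 bounds the minimum from above.\<close>
        case True
        then have "?h 0 = l" using j i assms by simp
        then have "?x i \<le> 0" using min[of 0] ne by simp
        then show ?thesis using True assms by simp
      next
        case False
        then have "j < ?N" "?h j = l" "\<not> j \<le> i" using j i(2) by auto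
        then have "?x i \<le> ?x j" "?x j \<noteq> ?x i" using min[of j] max[of j] i(3) by metis+
        then show ?thesis by simp
      qed
    next
      fix j assume j: "j \<in> {..i}" "?h j = ?h i"
      then show "?x i < ?x j + 1" using min[of j] i by simp
    qed
    with i show "l \<in> ?h ` {r \<in> {..<?N}. slit (rotate r v)}" by blast
  qed auto
  with levels card_image[OF inj] show ?thesis by simp
qed

text \<open>Count pairs of a word and an admissible rotation offset in two ways: by words with the
  cycle lemma, and by offsets, using that every rotation permutes the words.\<close>

lemma card_slit_words:
  "N * card {v \<in> words steps N (1, 0). slit v} =
    (\<Sum>v\<in>words steps N (1, 0). card (levels (map snd v)))"
proof -
  let ?W = "words steps N (1, 0)"
  have "(\<Sum>v\<in>?W. card (levels (map snd v))) = (\<Sum>v\<in>?W. card {r \<in> {..<N}. slit (rotate r v)})"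
    using card_slit_rotations by (intro sum.cong) (auto simp: words_def)
  also have "\<dots> = (\<Sum>r<N. card {v \<in> ?W. slit (rotate r v)})"
    by (rule sum_card_swap) auto
  also have "\<dots> = N * card {v \<in> ?W. slit v}"
    by (simp add: card_words_rotate)
  finally show ?thesis ..
qed

section \<open>Walks and their words of steps\<close>

lemma walk_count_eq_card_slit_words:
  "walk_count (1, 0) N = card {v \<in> words steps N (1, 0). slit v}"
proof -
  \<comment> \<open>The vertices are the partial sums of the steps; the inverse map takes successive
    differences.\<close>
  define f where "f = (\<lambda>v::(int \<times> int) list. map (psum v) [0..<N + 1])"
  let ?A = "{v \<in> words steps N (1, 0). slit v}"
  have nth_f: "f v ! i = psum v i" if "i \<le> N" for v i
    using that by (simp add: f_def del: upt_Suc)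
  have len_f: "length (f v) = N + 1" for v by (simp add: f_def)
  have diff: "v ! i = f v ! (i + 1) - f v ! i" if "length v = N" "i < N" for v i
    using that by (simp add: nth_f psum_Suc)
  have avoid: "(\<forall>k\<ge>0. p \<noteq> (- k, 0)) \<longleftrightarrow> (snd p = 0 \<longrightarrow> fst p > 0)" for p :: "int \<times> int"
  proof
    assume L: "\<forall>k\<ge>0. p \<noteq> (- k, 0)"
    show "snd p = 0 \<longrightarrow> fst p > 0"
      using L[rule_format, of "- fst p"] by (cases p) (simp, linarith)
  qed (auto)
  have inj: "inj_on f ?A"
  proof (rule inj_onI)
    fix u v assume "u \<in> ?A" "v \<in> ?A" "f u = f v"
    then show "u = v"
      by (intro nth_equalityI) (simp_all add: words_def diff)
  qed
  have "f ` ?A = slit_walks N (1, 0)"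
  proof (intro equalityI subsetI)
    fix w assume "w \<in> f ` ?A"
    then obtain v where v: "v \<in> ?A" "w = f v" by auto
    then have len: "length v = N" and sum: "sum_list v = (1, 0)" and st: "set v \<subseteq> steps"
      and sl: "slit v" by (auto simp: words_def)
    have "w ! (i + 1) - w ! i \<in> steps" if "i < N" for i
      using diff[OF len that] st that len v by (metis nth_mem subsetD)
    moreover have "\<forall>k\<ge>0. w ! i \<noteq> (- k, 0)" if "i \<in> {1..N}" for i
      unfolding avoid using that sl v len nth_f[of i v] by (simp add: slit_def)
    moreover have "w ! N = (1, 0)" using nth_f[of N v] v sum len psum_length[of v] by simp
    moreover have "w ! 0 = (0, 0)" using nth_f[of 0 v] v by (simp add: zero_prod_def)
    ultimately show "w \<in> slit_walks N (1, 0)"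
      using v len_f by (simp add: slit_walks_def)
  next
    fix w assume w: "w \<in> slit_walks N (1, 0)"
    define v where "v = map (\<lambda>i. w ! (i + 1) - w ! i) [0..<N]"
    have len: "length v = N" by (simp add: v_def)
    have ps: "psum v i = w ! i" if "i \<le> N" for i
      using that
    proof (induction i)
      case 0
      then show ?case using w by (simp add: slit_walks_def zero_prod_def)
    next
      case (Suc i)
      then show ?case using len by (simp add: psum_Suc) (simp add: v_def)
    qed
    have "sum_list v = (1, 0)"
      using ps[of N] psum_length[of v] w len by (simp add: slit_walks_def)
    moreover have "set v \<subseteq> steps" using w by (auto simp: v_def slit_walks_def)
    moreover have "slit v"
      unfolding slit_def
    proof
      fix i assume i: "i \<in> {1..length v}"
      then have "\<forall>k\<ge>0. w ! i \<noteq> (- k, 0)" using w len by (simp add: slit_walks_def)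
      then show "snd (psum v i) = 0 \<longrightarrow> 0 < fst (psum v i)"
        unfolding avoid using ps[of i] i len by simp
    qed
    ultimately have "v \<in> ?A" using len by (simp add: words_def)
    moreover have "f v = w"
      using w ps len_f by (intro nth_equalityI) (auto simp: nth_f slit_walks_def)
    ultimately show "w \<in> f ` ?A" by blast
  qed
  with inj show ?thesis by (metis card_image walk_count_def)
qed

section \<open>Separating vertical and horizontal steps\<close>

lemma levels_Cons: "levels (y # ys) = insert 0 ((+) y ` levels ys)"
proof -
  have 1: "psum (y # ys) (Suc i) = y + psum ys i" for i
    by (simp add: psum_def)
  have 2: "{..length (y # ys)} = insert 0 (Suc ` {..length ys})"
    by (simp add: atMost_Suc_eq_insert_0 del: image_Suc_atMost)
  show ?thesis
    unfolding levels_def 2 by (simp only: image_insert image_image 1 psum_0)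
qed

lemma zero_in_levels: "0 \<in> levels ys"
  unfolding levels_def by (rule image_eqI[of _ _ 0]) auto

text \<open>A letter 0 shifts nothing, and the height 0 that it contributes is visited
  anyway.\<close>

lemma levels_filter_nonzero: "levels (filter (\<lambda>y. y \<noteq> 0) ys) = levels ys"
proof (induction ys)
  case (Cons y ys)
  show ?case
  proof (cases "y = 0")
    case True
    have "(+) (0::int) ` levels ys = levels ys" by simp
    then show ?thesis using True Cons.IH by (simp add: levels_Cons insert_absorb zero_in_levels)
  next
    case False
    then show ?thesis using Cons.IH by (simp add: levels_Cons)
  qed
qed simp

lemma sum_list_filter_nonzero: "sum_list (filter (\<lambda>y. y \<noteq> 0) ys) = sum_list ys"
  for ys :: "'a::comm_monoid_add list"
  by (induction ys) auto

section \<open>Counting words over two letters\<close>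

lemma card_two_letter_words:
  assumes "p \<noteq> q"
  shows "card {v. set v \<subseteq> {p, q} \<and> length v = n \<and> count_list v p = k} = n choose k"
proof (induction n arbitrary: k)
  case 0
  have "{v. set v \<subseteq> {p, q} \<and> length v = 0 \<and> count_list v p = k} = (if k = 0 then {[]} else {})"
    by auto
  then show ?case by (cases k) auto
next
  case (Suc n)
  define W where "W = (\<lambda>n k. {v. set v \<subseteq> {p, q} \<and> length v = n \<and> count_list v p = k})"
  have fin: "finite (W n k)" for n k
    unfolding W_def by (rule finite_subset[OF _ finite_lists_length_eq[of "{p, q}" n]]) auto
  show ?case
  proof (cases k)
    case 0
    have "W (Suc n) 0 = Cons q ` W n 0"
      using assms by (auto simp: W_def length_Suc_conv image_iff)
    then show ?thesis using 0 Suc[of 0] by (simp add: W_def card_image)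
  next
    case (Suc j)
    \<comment> \<open>Splitting by the first letter gives Pascal's rule.\<close>
    have "W (Suc n) (Suc j) = Cons p ` W n j \<union> Cons q ` W n (Suc j)"
      using assms by (auto simp: W_def length_Suc_conv image_iff)
    moreover have "Cons p ` W n j \<inter> Cons q ` W n (Suc j) = {}"
      using assms by auto
    ultimately have "card (W (Suc n) (Suc j)) = card (W n j) + card (W n (Suc j))"
      using fin by (simp add: card_Un_disjoint card_image)
    then show ?thesis using Suc Suc.IH by (simp add: W_def)
  qed
qed

lemma sum_list_two_letters:
  fixes p q :: int
  assumes "p \<noteq> q" "set v \<subseteq> {p, q}"
  shows "sum_list v = int (count_list v p) * p + (int (length v) - int (count_list v p)) * q"
  using assms by (induction v) (auto simp: algebra_simps)

text \<open>Sum 1 forces \<open>n = 2k + 1\<close> with \<open>k + 1\<close> letters 1, and symmetry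
  turns \<open>n choose (k + 1)\<close> into \<open>n choose k\<close>. For even \<open>n\<close>
  the lower entry is not a natural number, matching the absence of words.\<close>

lemma card_horizontal_words:
  "real (card (words {1, -1} n (1::int))) = binom n ((real n - 1) / 2)"
proof (cases "odd n")
  case True
  then obtain k where n: "n = 2 * k + 1" by (elim oddE)
  have "words {1, -1} n (1::int) = {v. set v \<subseteq> {1, -1} \<and> length v = n \<and> count_list v 1 = k + 1}"
    using sum_list_two_letters[of 1 "-1"] by (auto simp: words_def n)
  then have "card (words {1, -1} n (1::int)) = n choose (k + 1)"
    using card_two_letter_words[of "1::int" "-1" n "k + 1"] by simp
  also have "\<dots> = n choose k" using binomial_symmetric[of k n] n by simp
  finally show ?thesis by (simp add: binom_def n)
next
  case False
  have "words {1, -1} n (1::int) = {}"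
    using False sum_list_two_letters[of 1 "-1"] by (auto simp: words_def) presburger
  moreover have "(real n - 1) / 2 \<notin> \<nat>"
  proof
    assume "(real n - 1) / 2 \<in> \<nat>"
    then obtain k where "(real n - 1) / 2 = real k" by (auto elim: Nats_cases)
    then have "real n = real (2 * k + 1)" by simp
    then have "n = 2 * k + 1" by linarith
    with False show False by simp
  qed
  ultimately show ?thesis by (simp add: binom_def)
qed

lemma card_vertical_words:
  "card (words {2, -1} (3 * k) (0::int)) = (3 * k) choose k"
proof -
  have "words {2, -1} (3 * k) (0::int) =
      {v. set v \<subseteq> {2, -1} \<and> length v = 3 * k \<and> count_list v 2 = k}"
    using sum_list_two_letters[of 2 "-1"] by (auto simp: words_def)
  then show ?thesis using card_two_letter_words[of "2::int" "-1" "3 * k" k] by simp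
qed

text \<open>The sum is three times the number of letters 2 minus the length.\<close>

lemma vertical_words_empty:
  assumes "\<not> 3 dvd n"
  shows "words {2, -1} n (0::int) = {}"
proof -
  have "3 dvd length v" if "set v \<subseteq> {2, -1}" "sum_list v = (0::int)" for v
    using sum_list_two_letters[of 2 "-1" v] that by simp presburger
  then show ?thesis using assms by (auto simp: words_def)
qed

text \<open>At \<open>n = 3M\<close> this is the \<open>e(M)\<close> of the overview.\<close>

definition total_levels :: "nat \<Rightarrow> nat" where
  "total_levels n = (\<Sum>y\<in>words {2, -1} n 0. card (levels y))"

text \<open>Group the words by their pair of vertical and horizontal subwords. Only the vertical one
  affects the visited heights, and the words with a given pair are the shuffles of two lists with
  disjoint letters, \<open>N choose a\<close> in number.\<close>

lemma sum_card_levels: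
  "(\<Sum>v\<in>words steps N (1, 0). card (levels (map snd v))) =
    (\<Sum>a\<le>N. (N choose a) * total_levels a * card (words {1, -1} (N - a) (1::int)))"
proof -
  let ?W = "words steps N (1, 0)"
  define P where "P = (\<lambda>s::int \<times> int. fst s = 0)"
  define g where "g = (\<lambda>v. (map snd (filter P v), map fst (filter (\<lambda>s. \<not> P s) v)))"
  define T where "T = (\<lambda>a. words {2, -1} a (0::int) \<times> words {1, -1} (N - a) (1::int))"
  have snd_filter: "map snd (filter P v) = filter (\<lambda>y. y \<noteq> 0) (map snd v)"
    if "set v \<subseteq> steps" for v
    using that by (induction v) (auto simp: P_def steps_def)
  have T: "g v \<in> (\<Union>a\<le>N. T a)" if "v \<in> ?W" for v
  proof -
    have v: "set v \<subseteq> steps" "length v = N" "sum_list v = (1, 0)" using that by (auto simp: words_def)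
    have "sum_list (map snd (filter P v)) = 0"
      using v snd_sum_list[of v] by (simp add: snd_filter sum_list_filter_nonzero)
    moreover have "map fst (filter (\<lambda>s. \<not> P s) v) = filter (\<lambda>y. y \<noteq> 0) (map fst v)"
      by (simp add: P_def filter_map comp_def)
    then have "sum_list (map fst (filter (\<lambda>s. \<not> P s) v)) = 1"
      using v fst_sum_list[of v] by (simp add: sum_list_filter_nonzero)
    ultimately have "g v \<in> T (length (filter P v))"
      using v sum_length_filter_compl[of P v]
      by (auto simp: g_def T_def words_def P_def steps_def)
    moreover have "length (filter P v) \<le> N" using v by auto
    ultimately show ?thesis by blast
  qed
  have levels: "levels (map snd v) = levels (fst (g v))" if "v \<in> ?W" for v
  proof -
    have "set v \<subseteq> steps" using that by (auto simp: words_def)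
    then show ?thesis by (simp add: g_def snd_filter levels_filter_nonzero)
  qed
  have fibre: "card {v \<in> ?W. g v = t} = N choose a" if "t \<in> T a" "a \<le> N" for a t
  proof -
    obtain ys xs where t: "t = (ys, xs)" by (cases t)
    let ?ys = "map (Pair 0) ys" and ?xs = "map (\<lambda>x. (x, 0)) xs"
    have ys: "set ys \<subseteq> {2, -1}" "length ys = a" "sum_list ys = 0"
      and xs: "set xs \<subseteq> {1, -1}" "length xs = N - a" "sum_list xs = 1"
      using that t by (auto simp: T_def words_def)
    have Pys: "\<forall>s\<in>set ?ys. P s" and Pxs: "\<forall>s\<in>set ?xs. \<not> P s"
      using xs by (auto simp: P_def)
    have "{v \<in> ?W. g v = t} = shuffles ?ys ?xs"
    proof (intro equalityI subsetI)
      fix v assume v: "v \<in> {v \<in> ?W. g v = t}"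
      then have st: "set v \<subseteq> steps" by (auto simp: words_def)
      have "filter P v = map (Pair 0) (map snd (filter P v))"
        using st by (induction v) (auto simp: P_def)
      moreover have "filter (\<lambda>s. \<not> P s) v = map (\<lambda>x. (x, 0)) (map fst (filter (\<lambda>s. \<not> P s) v))"
        using st by (induction v) (auto simp: P_def steps_def)
      ultimately have "filter P v = ?ys" "filter (\<lambda>s. \<not> P s) v = ?xs"
        using v t by (auto simp: g_def)
      then show "v \<in> shuffles ?ys ?xs" using partition_in_shuffles[of v P] by simp
    next
      fix v assume v: "v \<in> shuffles ?ys ?xs"
      have "partition P -` {(?ys, ?xs)} = shuffles ?ys ?xs"
        using Pys Pxs by (intro inv_image_partition) blast+
      with v have "v \<in> partition P -` {(?ys, ?xs)}" by blast
      then have part: "filter P v = ?ys" "filter (\<lambda>s. \<not> P s) v = ?xs"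
        by (simp_all add: comp_def)
      then have gv: "g v = t" using t by (simp add: g_def comp_def)
      have "set v = set ?ys \<union> set ?xs" using v set_shuffles by metis
      then have st: "set v \<subseteq> steps" using ys xs by (auto simp: steps_def)
      have len: "length v = N"
        using length_shuffles[OF v] ys xs that by simp
      have 1: "sum_list (map snd v) = 0"
        using snd_filter[OF st] sum_list_filter_nonzero[of "map snd v"] part ys by (simp add: comp_def)
      have "map fst (filter (\<lambda>s. \<not> P s) v) = filter (\<lambda>y. y \<noteq> 0) (map fst v)"
        by (simp add: P_def filter_map comp_def)
      then have 2: "sum_list (map fst v) = 1"
        using sum_list_filter_nonzero[of "map fst v"] part xs by (simp add: comp_def)
      have "sum_list v = (1, 0)"
        using 1 2 by (simp add: prod_eq_iff fst_sum_list snd_sum_list)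
      then show "v \<in> {v \<in> ?W. g v = t}" using st len gv by (simp add: words_def)
    qed
    moreover have "set ?ys \<inter> set ?xs = {}" using Pys Pxs by blast
    ultimately show ?thesis using card_disjoint_shuffles[of ?ys ?xs] ys xs that by simp
  qed
  have finT: "finite (T a)" for a by (simp add: T_def)
  have "(\<Sum>v\<in>?W. card (levels (map snd v))) = (\<Sum>v\<in>?W. card (levels (fst (g v))))"
    using levels by simp
  also have "\<dots> = (\<Sum>t\<in>(\<Union>a\<le>N. T a). \<Sum>v\<in>{v \<in> ?W. g v = t}. card (levels (fst (g v))))"
    using T finT by (intro sum.group[symmetric]) auto
  also have "\<dots> = (\<Sum>t\<in>(\<Union>a\<le>N. T a). card {v \<in> ?W. g v = t} * card (levels (fst t)))"
    by simp
  \<comment> \<open>The sets \<open>T a\<close> are disjoint because \<open>a\<close> is the length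
    of the first component.\<close>
  also have "\<dots> = (\<Sum>a\<le>N. \<Sum>t\<in>T a. card {v \<in> ?W. g v = t} * card (levels (fst t)))"
    using finT by (intro sum.UNION_disjoint) (auto simp: T_def words_def)
  also have "\<dots> = (\<Sum>a\<le>N. \<Sum>t\<in>T a. (N choose a) * card (levels (fst t)))"
    using fibre by simp
  also have "\<dots> = (\<Sum>a\<le>N. (N choose a) * total_levels a * card (words {1, -1} (N - a) (1::int)))"
    by (simp add: T_def total_levels_def sum.cartesian_product' sum_distrib_left
        sum_distrib_right algebra_simps)
  finally show ?thesis .
qed

section \<open>The renewal equation for closed vertical words\<close>

text \<open>Each value is represented by the last position at which it is taken.\<close>

lemma card_image_lessThan:
  "card (f ` {..<n::nat}) = card {p \<in> {..<n}. \<forall>q. p < q \<and> q < n \<longrightarrow> f q \<noteq> f p}" (is "_ = card ?L")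
proof -
  have inj: "inj_on f ?L"
  proof (rule linorder_inj_onI')
    fix i j assume "i \<in> ?L" "j \<in> ?L" "i < j"
    then have "f j \<noteq> f i" by blast
    then show "f i \<noteq> f j" by (rule not_sym)
  qed
  have "f ` ?L = f ` {..<n}"
  proof (intro equalityI subsetI)
    fix y assume "y \<in> f ` {..<n}"
    then obtain p0 where p0: "p0 < n" "f p0 = y" by auto
    define S where "S = {p. p < n \<and> f p = y}"
    have S: "finite S" "S \<noteq> {}" using p0 by (auto simp: S_def)
    define m where "m = Max S"
    have m: "m < n" "f m = y"
      using Max_in[OF S] by (simp_all add: S_def m_def)
    have "f q \<noteq> y" if "m < q" "q < n" for q
    proof
      assume "f q = y"
      with that have "q \<in> S" by (simp add: S_def)
      with S(1) have "q \<le> m" unfolding m_def by (rule Max_ge)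
      then show False using that by simp
    qed
    with m have "m \<in> ?L" by simp
    with m(2) show "y \<in> f ` ?L" by blast
  qed blast
  with card_image[OF inj] show ?thesis by simp
qed

definition no_return :: "'a::comm_monoid_add list \<Rightarrow> nat \<Rightarrow> bool" where
  "no_return v p \<longleftrightarrow> (\<forall>j\<in>{1..p}. psum v j \<noteq> 0)"

text \<open>Count each height at its last visit \<open>p < n\<close>. The rotation starting there
  does not return to 0 during the \<open>n - 1 - p\<close> positions left before \<open>n\<close>.
  As rotations permute the words, only this number matters, and it runs through all values below
  \<open>n\<close>.\<close>

lemma total_levels_eq_sum_no_return:
  assumes "0 < n"
  shows "total_levels n = (\<Sum>p<n. card {y \<in> words {2, -1} n (0::int). no_return y p})"
proof -
  let ?B = "words {2, -1} n (0::int)"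
  have rot: "(\<forall>q. p < q \<and> q < n \<longrightarrow> psum y q \<noteq> psum y p) \<longleftrightarrow> no_return (rotate p y) (n - 1 - p)"
    if "y \<in> ?B" "p < n" for y p
  proof -
    have y: "length y = n" using that by (simp add: words_def)
    have ps: "psum (rotate p y) j = psum y (p + j) - psum y p" if "j \<le> n - 1 - p" for j
    proof -
      have "j \<le> length y" "p + j \<le> length y" using that \<open>p < n\<close> y by linarith+
      then show ?thesis using psum_rotate[of p y j] \<open>p < n\<close> y by simp
    qed
    show ?thesis
    proof
      assume L: "\<forall>q. p < q \<and> q < n \<longrightarrow> psum y q \<noteq> psum y p"
      show "no_return (rotate p y) (n - 1 - p)"
        unfolding no_return_def
      proof
        fix j assume j: "j \<in> {1..n - 1 - p}"
        then have "psum y (p + j) \<noteq> psum y p" using L by auto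
        then show "psum (rotate p y) j \<noteq> 0" using ps[of j] j by simp
      qed
    next
      assume R: "no_return (rotate p y) (n - 1 - p)"
      show "\<forall>q. p < q \<and> q < n \<longrightarrow> psum y q \<noteq> psum y p"
      proof (intro allI impI)
        fix q assume q: "p < q \<and> q < n"
        then have "q - p \<in> {1..n - 1 - p}" by auto
        then have "psum (rotate p y) (q - p) \<noteq> 0"
          using R unfolding no_return_def by blast
        then show "psum y q \<noteq> psum y p" using ps[of "q - p"] q by auto
      qed
    qed
  qed
  have "total_levels n =
      (\<Sum>y\<in>?B. card {p \<in> {..<n}. \<forall>q. p < q \<and> q < n \<longrightarrow> psum y q \<noteq> psum y p})"
    unfolding total_levels_def
  proof (rule sum.cong[OF refl])
    fix y assume "y \<in> ?B"
    then have y: "length y = n" "sum_list y = 0" by (auto simp: words_def)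
    then have "y \<noteq> []" using assms by auto
    then have "levels y = psum y ` {..<n}" using y levels_eq_below_length by blast
    then show "card (levels y) = card {p \<in> {..<n}. \<forall>q. p < q \<and> q < n \<longrightarrow> psum y q \<noteq> psum y p}"
      by (simp only: card_image_lessThan)
  qed
  also have "\<dots> = (\<Sum>p<n. card {y \<in> ?B. \<forall>q. p < q \<and> q < n \<longrightarrow> psum y q \<noteq> psum y p})"
    by (rule sum_card_swap) auto
  also have "\<dots> = (\<Sum>p<n. card {y \<in> ?B. no_return (rotate p y) (n - 1 - p)})"
  proof (rule sum.cong[OF refl])
    fix p assume "p \<in> {..<n}"
    then have "{y \<in> ?B. \<forall>q. p < q \<and> q < n \<longrightarrow> psum y q \<noteq> psum y p} =
        {y \<in> ?B. no_return (rotate p y) (n - 1 - p)}"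
      using rot by blast
    then show "card {y \<in> ?B. \<forall>q. p < q \<and> q < n \<longrightarrow> psum y q \<noteq> psum y p} =
        card {y \<in> ?B. no_return (rotate p y) (n - 1 - p)}" by (rule arg_cong)
  qed
  also have "\<dots> = (\<Sum>p<n. card {y \<in> ?B. no_return y (n - 1 - p)})"
    by (rule sum.cong[OF refl]) (rule card_words_rotate, simp)
  also have "\<dots> = (\<Sum>p<n. card {y \<in> ?B. no_return y p})"
    using sum.nat_diff_reindex[of "\<lambda>p. card {y \<in> ?B. no_return y p}" n]
    by simp
  finally show ?thesis .
qed

text \<open>Cut the word at the zero \<open>i\<close>: the prefix is an arbitrary closed word, and
  the suffix is a closed word that stays away from 0 for \<open>p - i\<close> steps.\<close>

lemma card_last_zero:
  fixes S :: "'a::ab_group_add set"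
  assumes "i \<le> p" "p \<le> n"
  shows "card {v \<in> words S n 0. psum v i = 0 \<and> (\<forall>j. i < j \<and> j \<le> p \<longrightarrow> psum v j \<noteq> 0)} =
    card (words S i 0) * card {v \<in> words S (n - i) 0. no_return v (p - i)}"
    (is "card ?L = card ?X * card ?Y")
proof -
  have "bij_betw (\<lambda>(u, v). u @ v) (?X \<times> ?Y) ?L"
  proof (rule bij_betw_byWitness[where f' = "\<lambda>v. (take i v, drop i v)"])
    show "\<forall>a\<in>?X \<times> ?Y. (\<lambda>v. (take i v, drop i v)) ((\<lambda>(u, v). u @ v) a) = a"
      by (auto simp: words_def)
    show "\<forall>v\<in>?L. (\<lambda>(u, v). u @ v) (take i v, drop i v) = v" by simp
    show "(\<lambda>(u, v). u @ v) ` (?X \<times> ?Y) \<subseteq> ?L"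
    proof clarify
      fix u v assume u: "u \<in> ?X" and v: "v \<in> words S (n - i) 0" "no_return v (p - i)"
      have lu: "length u = i" "sum_list u = 0" using u by (auto simp: words_def)
      have ps: "psum (u @ v) (i + j) = psum v j" for j
        using psum_append_add[of u v j] lu by simp
      have "u @ v \<in> words S n 0" using u v assms by (auto simp: words_def)
      moreover have "psum (u @ v) i = 0" using ps[of 0] by simp
      moreover have "psum (u @ v) j \<noteq> 0" if "i < j" "j \<le> p" for j
      proof -
        have "j - i \<in> {1..p - i}" using that by auto
        then have "psum v (j - i) \<noteq> 0" using v(2) unfolding no_return_def by blast
        then show ?thesis using ps[of "j - i"] that by simp
      qed
      ultimately show "u @ v \<in> words S n 0 \<and> psum (u @ v) i = 0 \<and>
          (\<forall>j. i < j \<and> j \<le> p \<longrightarrow> psum (u @ v) j \<noteq> 0)" by blast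
    qed
    show "(\<lambda>v. (take i v, drop i v)) ` ?L \<subseteq> ?X \<times> ?Y"
    proof clarify
      fix v assume v: "v \<in> words S n 0" "psum v i = 0" "\<forall>j. i < j \<and> j \<le> p \<longrightarrow> psum v j \<noteq> 0"
      have lv: "length v = n" "sum_list v = 0" "set v \<subseteq> S" using v(1) by (auto simp: words_def)
      have "sum_list (take i v) + sum_list (drop i v) = 0"
        using lv by (metis append_take_drop_id sum_list_append)
      then have 1: "take i v \<in> words S i 0" "drop i v \<in> words S (n - i) 0"
        using lv v(2) assms set_take_subset[of i v] set_drop_subset[of i v]
        by (auto simp: words_def psum_def)
      have "no_return (drop i v) (p - i)"
        using v(2,3) lv assms by (auto simp: no_return_def psum_drop)
      with 1 show "take i v \<in> words S i 0 \<and> drop i v \<in> {v \<in> words S (n - i) 0. no_return v (p - i)}"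
        by blast
    qed
  qed
  then show ?thesis by (simp add: bij_betw_same_card[symmetric] card_cartesian_product)
qed

text \<open>Both sides count pairs of a closed word of length \<open>n\<close> and a position \<open>p < n\<close>, the right-hand
  side according to the last zero \<open>i \<le> p\<close> of the partial sums.\<close>

lemma total_levels_renewal:
  "n * card (words {2, -1} n (0::int)) =
    (\<Sum>i<n. card (words {2, -1} i (0::int)) * total_levels (n - i))"
proof -
  let ?B = "\<lambda>n. words {2, -1} n (0::int)"
  let ?Q = "\<lambda>p i v. psum v i = 0 \<and> (\<forall>j. i < j \<and> j \<le> p \<longrightarrow> psum v j \<noteq> 0)"
  \<comment> \<open>A last zero up to \<open>p\<close> exists because position 0 is a zero.\<close>
  have one: "card {i \<in> {..p}. ?Q p i v} = 1" if "v \<in> ?B n" for p v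
  proof -
    define S where "S = {i. i \<le> p \<and> psum v i = 0}"
    have S: "finite S" "S \<noteq> {}" by (auto simp: S_def intro: exI[of _ 0])
    have "Max S \<in> S" using S by (rule Max_in)
    moreover have "j \<le> Max S" if "j \<le> p" "psum v j = 0" for j
      using Max_ge[OF S(1), of j] that by (auto simp: S_def)
    ultimately have "Max S \<le> p" "psum v (Max S) = 0" "\<not> (Max S < j \<and> j \<le> p \<and> psum v j = 0)" for j
      by (auto simp: S_def not_less)
    moreover have "i = Max S" if "i \<le> p" "?Q p i v" for i
    proof (rule antisym)
      show "i \<le> Max S" using Max_ge[OF S(1), of i] that by (auto simp: S_def)
      show "Max S \<le> i" using that \<open>Max S \<in> S\<close> by (metis (mono_tags) S_def mem_Collect_eq not_less)
    qed
    ultimately have "{i \<in> {..p}. ?Q p i v} = {Max S}" by blast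
    then show ?thesis by simp
  qed
  have "n * card (?B n) = (\<Sum>p<n. \<Sum>v\<in>?B n. card {i \<in> {..p}. ?Q p i v})"
    using one by simp
  also have "\<dots> = (\<Sum>p<n. \<Sum>i\<le>p. card {v \<in> ?B n. ?Q p i v})"
    by (intro sum.cong[OF refl] sum_card_swap) auto
  also have "\<dots> = (\<Sum>p<n. \<Sum>i\<le>p. card (?B i) * card {v \<in> ?B (n - i). no_return v (p - i)})"
    by (intro sum.cong[OF refl] card_last_zero) auto
  \<comment> \<open>Exchanging the sums over \<open>i \<le> p < n\<close> leaves, for fixed
    \<open>i\<close>, a sum over \<open>p - i < n - i\<close>, which is the one in
    \<open>total_levels_eq_sum_no_return\<close>.\<close>
  also have "\<dots> = (\<Sum>i<n. \<Sum>p\<in>{i..<n}. card (?B i) * card {v \<in> ?B (n - i). no_return v (p - i)})"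
    unfolding sum.Sigma[OF finite_lessThan ballI[OF finite_atMost]]
      sum.Sigma[OF finite_lessThan ballI[OF finite_atLeastLessThan]]
    by (rule sum.reindex_bij_witness[of _ "\<lambda>(i, p). (p, i)" "\<lambda>(p, i). (i, p)"]) auto
  also have "\<dots> = (\<Sum>i<n. card (?B i) * total_levels (n - i))"
  proof (rule sum.cong[OF refl])
    fix i assume i: "i \<in> {..<n}"
    have "(\<Sum>p\<in>{i..<n}. card (?B i) * card {v \<in> ?B (n - i). no_return v (p - i)}) =
        (\<Sum>p<n - i. card (?B i) * card {v \<in> ?B (n - i). no_return v p})"
      using i by (intro sum.reindex_bij_witness[of _ "\<lambda>p. p + i" "\<lambda>p. p - i"]) auto
    also have "\<dots> = card (?B i) * total_levels (n - i)"
      using i total_levels_eq_sum_no_return[of "n - i"] by (simp add: sum_distrib_left)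
    finally show "(\<Sum>p\<in>{i..<n}. card (?B i) * card {v \<in> ?B (n - i). no_return v (p - i)}) =
        card (?B i) * total_levels (n - i)" .
  qed
  finally show ?thesis .
qed

section \<open>Solving the renewal equation\<close>

lemma sum_multiples_of_3:
  fixes f :: "nat \<Rightarrow> 'a::comm_monoid_add"
  assumes "finite A" "\<And>i. \<not> 3 dvd i \<Longrightarrow> f i = 0"
  shows "sum f A = (\<Sum>j | 3 * j \<in> A. f (3 * j))"
proof -
  have "sum f A = sum f ((*) 3 ` {j. 3 * j \<in> A})"
  proof (rule sum.mono_neutral_right[OF assms(1)])
    show "\<forall>i\<in>A - (*) 3 ` {j. 3 * j \<in> A}. f i = 0"
      by (auto intro!: assms(2))
  qed auto
  also have "\<dots> = (\<Sum>j | 3 * j \<in> A. f (3 * j))"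
    by (subst sum.reindex) (auto simp: inj_on_def)
  finally show ?thesis .
qed

text \<open>The Fuss-Catalan number \<open>(3k choose k) / (2k + 1)\<close>, which counts ternary
  trees with \<open>k\<close> inner nodes; it is the \<open>C(k)\<close> of the overview.\<close>

definition ternary_catalan :: "nat \<Rightarrow> real" where
  "ternary_catalan k = fact (3 * k) / (fact k * fact (2 * k + 1))"

text \<open>\<open>ballot h k\<close> is the number \<open>h / (3k + h) (3k + h choose k)\<close> of words over \<open>{2, -1}\<close> that
  reach height \<open>-h\<close> for the first time after \<open>3k + h\<close> steps, in a form without division.\<close>

fun ballot :: "nat \<Rightarrow> nat \<Rightarrow> real" where
  "ballot h 0 = 1"
| "ballot h (Suc k) = real ((3 * k + h + 3) choose Suc k) - 3 * real ((3 * k + h + 2) choose k)"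

text \<open>Absorption, \<open>(k + 1) (3k + 3 choose k + 1) = (3k + 3) (3k + 2 choose k)\<close>,
  with the factor \<open>k + 1\<close> cancelled.\<close>

lemma ballot_0: "ballot 0 (Suc k) = 0"
proof -
  have "Suc k * ((3 * k + 3) choose Suc k) = Suc k * (3 * ((3 * k + 2) choose k))"
  proof -
    have "3 * k + 3 = Suc (3 * k + 2)" by simp
    then have "Suc k * ((3 * k + 3) choose Suc k) = (3 * k + 3) * ((3 * k + 2) choose k)"
      by (metis Suc_times_binomial)
    then show ?thesis by (simp add: algebra_simps del: binomial_Suc_Suc)
  qed
  then have "(3 * k + 3) choose Suc k = 3 * ((3 * k + 2) choose k)"
    by (simp only: mult_cancel1) simp
  then have "real ((3 * k + 3) choose Suc k) = real (3 * ((3 * k + 2) choose k))"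
    by (rule arg_cong)
  then show ?thesis by (simp del: binomial_Suc_Suc)
qed

text \<open>Corresponds to removing the first letter: after \<open>-1\<close> the remaining descent
  is \<open>h\<close>, after \<open>2\<close> it is \<open>h + 3\<close> with one letter 2 fewer.
  The proof applies Pascal's rule to both binomials.\<close>

lemma ballot_Suc: "ballot (Suc h) (Suc k) = ballot h (Suc k) + ballot (h + 3) k"
proof (cases k)
  case (Suc j)
  have 1: "(3 * k + Suc h + 3) choose Suc k = ((3 * k + h + 3) choose k) + ((3 * k + h + 3) choose Suc k)"
  proof -
    have "3 * k + Suc h + 3 = Suc (3 * k + h + 3)" by simp
    then show ?thesis by (simp only: binomial_Suc_Suc)
  qed
  have 2: "(3 * k + Suc h + 2) choose k = ((3 * k + h + 2) choose j) + ((3 * k + h + 2) choose k)"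
  proof -
    have "3 * k + Suc h + 2 = Suc (3 * k + h + 2)" by simp
    then show ?thesis using Suc by (simp only: binomial_Suc_Suc)
  qed
  have 3: "ballot (h + 3) k = real ((3 * k + h + 3) choose k) - 3 * real ((3 * k + h + 2) choose j)"
    unfolding Suc by (simp add: algebra_simps del: binomial_Suc_Suc)
  show ?thesis
    unfolding 3 ballot.simps 1 2 by simp
qed simp

text \<open>A word with \<open>n\<close> letters 2 and length \<open>3n + a + h\<close> ends at
  height \<open>-(a + h)\<close>; the sum splits such words at their first visit to
  \<open>-h\<close>. The proof is a double induction through \<open>ballot_Suc\<close>, so the
  hypothesis for \<open>n\<close> must hold at \<open>h + 3\<close>.\<close>

lemma ballot_convolution:
  "(\<Sum>k\<le>n. ballot h k * real ((3 * (n - k) + a) choose (n - k))) = real ((3 * n + a + h) choose n)"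
proof (induction n arbitrary: h)
  case (Suc n)
  note outer = this
  let ?b = "\<lambda>n. real ((3 * n + a) choose n)"
  have split: "(\<Sum>k\<le>Suc n. ballot h k * ?b (Suc n - k)) =
      ?b (Suc n) + (\<Sum>k\<le>n. ballot h (Suc k) * ?b (n - k))" for h
    unfolding sum.atMost_Suc_shift by simp
  show ?case
  proof (induction h)
    case 0
    show ?case unfolding split by (simp only: ballot_0) simp
  next
    case (Suc h)
    have "(\<Sum>k\<le>Suc n. ballot (Suc h) k * ?b (Suc n - k)) =
        ?b (Suc n) + (\<Sum>k\<le>n. ballot h (Suc k) * ?b (n - k)) + (\<Sum>k\<le>n. ballot (h + 3) k * ?b (n - k))"
      unfolding split ballot_Suc by (simp only: distrib_right sum.distrib add.assoc)
    also have "\<dots> = real ((3 * Suc n + a + h) choose Suc n) + real ((3 * n + a + (h + 3)) choose n)"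
      using Suc.IH outer[of "h + 3"] unfolding split by (simp only:)
    also have "\<dots> = real ((3 * Suc n + a + Suc h) choose Suc n)"
    proof -
      have "3 * Suc n + a + Suc h = Suc (3 * n + a + h + 3)" "3 * Suc n + a + h = 3 * n + a + h + 3"
        "3 * n + a + (h + 3) = 3 * n + a + h + 3" by simp_all
      then show ?thesis by (simp only: binomial_Suc_Suc of_nat_add add.commute)
    qed
    finally show ?case .
  qed
qed simp

lemma ballot_1: "ballot 1 k = ternary_catalan k"
proof (cases k)
  case 0
  then show ?thesis by (simp add: ternary_catalan_def)
next
  case (Suc j)
  let ?F = "fact (3 * j + 3) :: real" and ?A = "fact (Suc j) :: real" and ?B = "fact (2 * j + 3) :: real"
  have 1: "real ((3 * j + 1 + 3) choose Suc j) = (3 * real j + 4) * ?F / (?A * ?B)"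
  proof -
    have "3 * j + 1 + 3 - Suc j = 2 * j + 3" by simp
    moreover have "fact (3 * j + 1 + 3) = (3 * real j + 4) * ?F"
      using fact_Suc[of "3 * j + 3", where 'a = real] by (simp add: algebra_simps)
    ultimately show ?thesis by (subst binomial_fact) simp_all
  qed
  have 2: "real ((3 * j + 1 + 2) choose j) = (real j + 1) * ?F / (?A * ?B)"
  proof -
    have "3 * j + 1 + 2 - j = 2 * j + 3" "3 * j + 1 + 2 = 3 * j + 3" by simp_all
    moreover have "?A = (real j + 1) * fact j" by (simp add: algebra_simps)
    ultimately have "real ((3 * j + 1 + 2) choose j) = ?F / (fact j * ?B)"
      using binomial_fact[of j "3 * j + 3", where 'a = real] by (simp only:)
    also have "\<dots> = (real j + 1) * ?F / ((real j + 1) * (fact j * ?B))"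
      by (rule mult_divide_mult_cancel_left[symmetric]) simp
    finally show ?thesis by (simp only: \<open>?A = _\<close> mult.assoc)
  qed
  \<comment> \<open>Over the common denominator the numerators combine by
    \<open>(3j + 4) - 3 (j + 1) = 1\<close>.\<close>
  have "ballot 1 k = ?F / (?A * ?B)"
    unfolding Suc ballot.simps 1 2 by (simp add: field_simps del: fact_Suc)
  moreover have "3 * Suc j = 3 * j + 3" "2 * Suc j + 1 = 2 * j + 3" by simp_all
  ultimately show ?thesis unfolding Suc ternary_catalan_def by (simp only:)
qed

text \<open>The solution of the renewal equation, given by the recurrence of the overview; its
  agreement with the counts is \<open>total_levels_eq_level_weight\<close>.\<close>

primrec level_weight :: "nat \<Rightarrow> real" where
  "level_weight 0 = 1"
| "level_weight (Suc M) = (27 * level_weight M + 9 * ternary_catalan M) / 4"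

lemma level_weight_closed_form:
  "level_weight M = (27 / 4) ^ M + (\<Sum>k<M. 9 / 4 * (27 / 4) ^ (M - 1 - k) * ternary_catalan k)"
proof (induction M)
  case (Suc M)
  have "(\<Sum>k<M. 9 / 4 * (27 / 4) ^ (Suc M - 1 - k) * ternary_catalan k) =
      27 / 4 * (\<Sum>k<M. 9 / 4 * (27 / 4) ^ (M - 1 - k) * ternary_catalan k)"
    unfolding sum_distrib_left
  proof (rule sum.cong[OF refl])
    fix k assume "k \<in> {..<M}"
    then have "Suc M - 1 - k = Suc (M - 1 - k)" by auto
    then show "9 / 4 * (27 / 4) ^ (Suc M - 1 - k) * ternary_catalan k =
        27 / 4 * (9 / 4 * (27 / 4) ^ (M - 1 - k) * ternary_catalan k)" by simp
  qed
  then show ?case using Suc.IH by (simp add: algebra_simps)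
qed simp

text \<open>The identity behind the induction step of \<open>level_weight_convolution\<close>. All
  binomials are rational multiples of \<open>3M choose M\<close>, which leaves an identity of
  rational functions in \<open>M\<close>.\<close>

lemma choose_3_times_step:
  "12 * (real M + 1) * real ((3 * Suc M) choose Suc M) =
    27 * (3 * real M + 1) * real ((3 * M) choose M) + 9 * real ((3 * M + 1) choose M)"
proof -
  let ?b = "real ((3 * M) choose M)"
  have b: "?b = fact (3 * M) / (fact M * fact (2 * M))"
    by (subst binomial_fact) simp_all
  have f1: "fact (3 * M + 1) = (3 * real M + 1) * fact (3 * M)" by simp
  have g1: "fact (2 * M + 1) = (2 * real M + 1) * fact (2 * M)" by simp
  have "3 * M + 1 - M = 2 * M + 1" by simp
  then have c: "real ((3 * M + 1) choose M) = (3 * real M + 1) / (2 * real M + 1) * ?b"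
    unfolding b by (subst binomial_fact) (simp_all only: f1 g1, simp_all)
  have "3 * Suc M = Suc (Suc (3 * M + 1))" "3 * Suc M - Suc M = Suc (2 * M + 1)" by simp_all
  then have "real ((3 * Suc M) choose Suc M) =
      fact (Suc (Suc (3 * M + 1))) / (fact (Suc M) * fact (Suc (2 * M + 1)))"
    using binomial_fact[of "Suc M" "3 * Suc M", where 'a = real] by (simp only:)
  also have "\<dots> = (3 * real M + 3) * (3 * real M + 2) * ((3 * real M + 1) * fact (3 * M)) /
      ((real M + 1) * fact M * ((2 * real M + 2) * ((2 * real M + 1) * fact (2 * M))))"
    unfolding fact_Suc f1 g1 by (simp only: fact_Suc f1[simplified] g1[simplified] of_nat_Suc of_nat_add of_nat_mult)
       (simp add: algebra_simps)
  also have "\<dots> = 3 * (3 * real M + 2) * (3 * real M + 1) / ((2 * real M + 2) * (2 * real M + 1)) * ?b"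
  proof -
    have cancel: "(3 * r) * x * (y * F) / (r * m * (w * (v * g))) = 3 * x * y / (w * v) * (F / (m * g))"
      if "r \<noteq> 0" for r x y F m w v g :: real
      using that by (simp add: mult_ac)
    have "3 * real M + 3 = 3 * (real M + 1)" by simp
    then show ?thesis unfolding b by (simp only:) (rule cancel, simp)
  qed
  finally have d: "real ((3 * Suc M) choose Suc M) =
      3 * (3 * real M + 2) * (3 * real M + 1) / (2 * (real M + 1) * (2 * real M + 1)) * ?b"
    by (simp add: algebra_simps)
  have "real M + 1 \<noteq> 0" "2 * real M + 1 \<noteq> 0" by linarith+
  then have "12 * (real M + 1) * (3 * (3 * real M + 2) * (3 * real M + 1) / (2 * (real M + 1) * (2 * real M + 1)) * B) =
      27 * (3 * real M + 1) * B + 9 * ((3 * real M + 1) / (2 * real M + 1) * B)" for B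
    by (simp add: divide_simps) (simp add: algebra_simps)
  then show ?thesis unfolding c d .
qed

lemma level_weight_convolution:
  "(\<Sum>i<M. real ((3 * i) choose i) * level_weight (M - i)) = 3 * real M * real ((3 * M) choose M)"
proof (induction M)
  case (Suc M)
  let ?b = "\<lambda>i. real ((3 * i) choose i)"
  \<comment> \<open>Splitting at the first visit to height -1, as \<open>ternary_catalan\<close> is
    \<open>ballot 1\<close>.\<close>
  have cat: "(\<Sum>i\<le>M. ?b i * ternary_catalan (M - i)) = real ((3 * M + 1) choose M)"
  proof -
    have "(\<Sum>i\<le>M. ?b i * ternary_catalan (M - i)) = (\<Sum>k\<le>M. ballot 1 k * ?b (M - k))"
      by (rule sum.reindex_bij_witness[of _ "\<lambda>i. M - i" "\<lambda>i. M - i"]) (auto simp: ballot_1[symmetric])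
    then show ?thesis using ballot_convolution[where n = M and h = 1 and a = 0] by (simp only: add_0_right)
  qed
  \<comment> \<open>The additional term \<open>i = M\<close> has \<open>level_weight\<close> 1 and
    raises the factor \<open>3M\<close> to \<open>3M + 1\<close>.\<close>
  have lw: "(\<Sum>i\<le>M. ?b i * level_weight (M - i)) = (3 * real M + 1) * ?b M"
  proof -
    have "{..M} = insert M {..<M}" by auto
    then show ?thesis using Suc.IH by (simp add: algebra_simps)
  qed
  have "4 * (\<Sum>i<Suc M. ?b i * level_weight (Suc M - i)) =
      (\<Sum>i\<le>M. 27 * (?b i * level_weight (M - i)) + 9 * (?b i * ternary_catalan (M - i)))"
    unfolding sum_distrib_left lessThan_Suc_atMost
    by (rule sum.cong[OF refl]) (simp add: Suc_diff_le algebra_simps)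
  also have "\<dots> = 27 * (3 * real M + 1) * ?b M + 9 * real ((3 * M + 1) choose M)"
    unfolding sum.distrib sum_distrib_left[symmetric] lw cat by simp
  also have "\<dots> = 12 * (real M + 1) * ?b (Suc M)"
    by (rule choose_3_times_step[symmetric])
  finally have "4 * (\<Sum>i<Suc M. ?b i * level_weight (Suc M - i)) = 4 * (3 * real (Suc M) * ?b (Suc M))"
    by (simp only: of_nat_Suc) (simp only: algebra_simps)
  then show ?case by (simp only: mult_cancel_left) simp
qed simp

text \<open>Both sequences satisfy the same convolution equation, in which the value at
  \<open>M\<close> has coefficient 1 and the others are earlier values. At \<open>M = 0\<close> that
  equation is empty; there the empty word visits one height.\<close>

lemma total_levels_eq_level_weight: "real (total_levels (3 * M)) = level_weight M"
proof (induction M rule: less_induct)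
  case (less M)
  let ?b = "\<lambda>i. real ((3 * i) choose i)"
  show ?case
  proof (cases "M = 0")
    case True
    have "words {2, -1} 0 (0::int) = {[]}" by (auto simp: words_def)
    then show ?thesis using True by (simp add: total_levels_def levels_def)
  next
    case False
    let ?f = "\<lambda>i. card (words {2, -1} i (0::int)) * total_levels (3 * M - i)"
    have "3 * M * ((3 * M) choose M) = sum ?f {..<3 * M}"
      using total_levels_renewal[of "3 * M"] by (simp add: card_vertical_words)
    also have "\<dots> = (\<Sum>j | 3 * j \<in> {..<3 * M}. ?f (3 * j))"
      by (rule sum_multiples_of_3) (auto simp: vertical_words_empty)
    also have "{j. 3 * j \<in> {..<3 * M}} = {..<M}" by auto
    also have "(\<Sum>j<M. ?f (3 * j)) = (\<Sum>j<M. ((3 * j) choose j) * total_levels (3 * (M - j)))"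
      by (simp add: card_vertical_words diff_mult_distrib2)
    finally have "real (3 * M * ((3 * M) choose M)) =
        real (\<Sum>j<M. ((3 * j) choose j) * total_levels (3 * (M - j)))" by (rule arg_cong)
    then have e: "3 * real M * ?b M = (\<Sum>j<M. ?b j * real (total_levels (3 * (M - j))))" by simp
    have split: "{..<M} = insert 0 {1..<M}" using False by auto
    have "(\<Sum>j\<in>{1..<M}. ?b j * real (total_levels (3 * (M - j)))) =
        (\<Sum>j\<in>{1..<M}. ?b j * level_weight (M - j))"
      using less.IH by (intro sum.cong) auto
    then show ?thesis
      using e level_weight_convolution[of M] unfolding split by simp
  qed
qed

section \<open>The counting formula\<close>

text \<open>Classifies the subsets of \<open>{0..n}\<close> with \<open>a + b + 1\<close> elements
  by their element \<open>i\<close> that has \<open>a\<close> smaller ones. The induction uses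
  Pascal's rule in \<open>b\<close>; the case \<open>b = 0\<close> is the hockey-stick
  identity.\<close>

lemma sum_choose_mult_choose:
  "(\<Sum>i\<le>n. (i choose a) * ((n - i) choose b)) = Suc n choose Suc (a + b)"
proof (induction n arbitrary: b)
  case 0
  then show ?case by (cases a; cases b) auto
next
  case (Suc n)
  show ?case
  proof (cases b)
    case 0
    then show ?thesis using sum_choose_upper[of a "Suc n"] by (simp add: atMost_atLeast0)
  next
    case (Suc c)
    have "(\<Sum>i\<le>Suc n. (i choose a) * ((Suc n - i) choose b)) =
        (\<Sum>i\<le>n. (i choose a) * ((n - i) choose c)) + (\<Sum>i\<le>n. (i choose a) * ((n - i) choose Suc c))"
      unfolding Suc sum.distrib[symmetric] by (simp add: Suc_diff_le algebra_simps)
    then show ?thesis using Suc.IH[of c] Suc.IH[of "Suc c"] Suc by simp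
  qed
qed

text \<open>The index \<open>M\<close> is the number of steps \<open>(0, 2)\<close>, so
  \<open>3M\<close> of the steps are vertical.\<close>

lemma walk_count_eq_sum_level_weights:
  "real N * real (walk_count (1, 0) N) =
    (\<Sum>M\<le>N div 3. real (N choose (3 * M)) * level_weight M *
      binom (N - 3 * M) ((real N - 3 * real M - 1) / 2))"
proof -
  let ?f = "\<lambda>a. real (N choose a) * real (total_levels a) * real (card (words {1, -1} (N - a) (1::int)))"
  have "real N * real (walk_count (1, 0) N) = real (N * walk_count (1, 0) N)" by simp
  also have "\<dots> = sum ?f {..N}"
    unfolding walk_count_eq_card_slit_words card_slit_words sum_card_levels by simp
  also have "\<dots> = (\<Sum>M | 3 * M \<in> {..N}. ?f (3 * M))"
    by (rule sum_multiples_of_3) (auto simp: total_levels_def vertical_words_empty)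
  also have "{M. 3 * M \<in> {..N}} = {..N div 3}" by auto
  also have "(\<Sum>M\<le>N div 3. ?f (3 * M)) = (\<Sum>M\<le>N div 3. real (N choose (3 * M)) * level_weight M *
      binom (N - 3 * M) ((real N - 3 * real M - 1) / 2))"
  proof (rule sum.cong[OF refl])
    fix M assume "M \<in> {..N div 3}"
    then have "3 * M \<le> N" by auto
    then have "real (N - 3 * M) - 1 = real N - 3 * real M - 1" by (simp add: of_nat_diff)
    then show "?f (3 * M) = real (N choose (3 * M)) * level_weight M *
        binom (N - 3 * M) ((real N - 3 * real M - 1) / 2)"
      by (simp only: total_levels_eq_level_weight card_horizontal_words)
  qed
  finally show ?thesis .
qed

section \<open>Matching the single and the triple sum\<close>

lemma choose_div_eq:
  assumes "0 < N" "0 < a"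
  shows "real (N choose a) / real N = real ((N - 1) choose (a - 1)) / real a"
proof -
  have "a * (N choose a) = N * ((N - 1) choose (a - 1))"
    using assms by (metis Suc_diff_1 Suc_times_binomial)
  then have "real a * real (N choose a) = real N * real ((N - 1) choose (a - 1))"
    by (metis of_nat_mult)
  then show ?thesis using assms by (simp add: field_simps)
qed

text \<open>The triple sum summed over \<open>n\<close> for fixed \<open>m\<close> and
  \<open>k\<close>; also the contribution of \<open>M = m + k + 1\<close> and \<open>k\<close> once
  \<open>level_weight\<close> is unfolded.\<close>

definition triple_sum_term :: "nat \<Rightarrow> nat \<Rightarrow> nat \<Rightarrow> real" where
  "triple_sum_term N m k = 3 ^ (3 * m + 2) / (real N * 2 ^ (2 * m + 2)) * ternary_catalan k *
    real (N choose (3 * m + 3 * k + 3)) *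
    binom (N - 3 * m - 3 * k - 3) ((real N - 3 * real m - 3 * real k - 4) / 2)"

text \<open>Cancel \<open>n\<close> against the factorial of \<open>n\<close> and expand by the
  factorial of \<open>3k\<close>.\<close>

lemma multinom_div:
  assumes "3 * k + 1 \<le> n"
  shows "multinom n k (2 * k + 1) (n - 3 * k - 1) / real n =
    ternary_catalan k * real ((n - 1) choose (3 * k))"
proof -
  obtain j where n: "n = Suc j" "3 * k \<le> j" using assms by (cases n) auto
  have "real (j choose (3 * k)) = fact j / (fact (3 * k) * fact (j - 3 * k))"
    using n by (simp add: binomial_fact)
  moreover have "n - 3 * k - 1 = j - 3 * k" using n by simp
  moreover have "fact n = real n * fact j" "real n \<noteq> 0" unfolding n(1) by simp_all
  moreover have "((x * f) / (a * b * c)) / x = t / (a * b) * (f / (t * c))"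
    if "t \<noteq> 0" "x \<noteq> 0" for f a b c x t :: real
    using that by simp
  ultimately show ?thesis
    unfolding multinom_def ternary_catalan_def by (simp add: n(1) del: fact_Suc of_nat_Suc)
qed

lemma sum_choose_mult_choose_range:
  assumes "3 * m + 3 * k + 3 \<le> N"
  shows "(\<Sum>n\<in>{3 * k + 1..N - 3 * m - 2}.
      real ((n - 1) choose (3 * k)) * real ((N - n) choose (3 * m + 2))) =
    real (N choose (3 * m + 3 * k + 3))"
proof -
  have "(\<Sum>n\<in>{3 * k + 1..N - 3 * m - 2}. ((n - 1) choose (3 * k)) * ((N - n) choose (3 * m + 2))) =
      (\<Sum>i\<in>{3 * k..N - 3 * m - 3}. (i choose (3 * k)) * ((N - 1 - i) choose (3 * m + 2)))"
    using assms by (intro sum.reindex_bij_witness[of _ Suc "\<lambda>n. n - 1"]) auto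
  \<comment> \<open>Outside the smaller range one of the two binomials vanishes.\<close>
  also have "\<dots> = (\<Sum>i\<le>N - 1. (i choose (3 * k)) * ((N - 1 - i) choose (3 * m + 2)))"
    using assms by (intro sum.mono_neutral_left) (auto simp: not_le binomial_eq_0)
  also have "\<dots> = N choose (3 * m + 3 * k + 3)"
  proof -
    have "Suc (N - 1) = N" "Suc (3 * k + (3 * m + 2)) = 3 * m + 3 * k + 3" using assms by simp_all
    then show ?thesis by (simp only: sum_choose_mult_choose)
  qed
  finally have "real (\<Sum>n\<in>{3 * k + 1..N - 3 * m - 2}.
      ((n - 1) choose (3 * k)) * ((N - n) choose (3 * m + 2))) = real (N choose (3 * m + 3 * k + 3))"
    by (rule arg_cong)
  then show ?thesis by simp
qed

lemma finite_pairs: "finite {(m, k). 3 * m + 3 * k + 3 \<le> (N::nat)}"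
  by (rule finite_subset[of _ "{..N} \<times> {..N}"]) auto

lemma sum_triples:
  "(\<Sum>(n, m, k) \<in> triples N.
      3 ^ (3 * m + 2) / (real n * real N * 2 ^ (2 * m + 2))
      * multinom n k (2 * k + 1) (n - 3 * k - 1)
      * real ((N - n) choose (3 * m + 2))
      * binom (N - 3 * m - 3 * k - 3) ((real N - 3 * real m - 3 * real k - 4) / 2)) =
    (\<Sum>(m, k) \<in> {(m, k). 3 * m + 3 * k + 3 \<le> N}. triple_sum_term N m k)"
    (is "sum ?f _ = sum _ ?P")
proof -
  define R where "R = (\<lambda>(m, k). {3 * k + 1..N - 3 * m - 2})"
  \<comment> \<open>Cleared of denominators, the real bounds become subtraction-free inequalities of
    naturals, which force \<open>3m + 3k + 3 \<le> N\<close>.\<close>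
  have triples: "(n, m, k) \<in> triples N \<longleftrightarrow> 3 * k + 1 \<le> n \<and> n + 3 * m + 2 \<le> N" for n m k
  proof -
    have "real m \<le> (real N - real n - 2) / 3 \<longleftrightarrow> real (n + 3 * m + 2) \<le> real N"
      by (simp add: field_simps)
    moreover have "real k \<le> (real n - 1) / 3 \<longleftrightarrow> real (3 * k + 1) \<le> real n"
      by (simp add: field_simps)
    ultimately show ?thesis unfolding triples_def of_nat_le_iff by auto
  qed
  have "sum ?f (triples N) = (\<Sum>(p, n)\<in>Sigma ?P R. ?f (n, p))"
    by (rule sum.reindex_bij_witness[of _ "\<lambda>(p, n). (n, p)" "\<lambda>(n, p). (p, n)"])
       (auto simp: triples R_def)
  also have "\<dots> = (\<Sum>p\<in>?P. \<Sum>n\<in>R p. ?f (n, p))"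
    by (rule sum.Sigma[symmetric]) (auto simp: finite_pairs R_def)
  also have "\<dots> = (\<Sum>(m, k) \<in> ?P. triple_sum_term N m k)"
  proof (rule sum.cong[OF refl])
    fix p assume "p \<in> ?P"
    then obtain m k where p: "p = (m, k)" and mk: "3 * m + 3 * k + 3 \<le> N" by auto
    let ?c = "3 ^ (3 * m + 2) / (real N * 2 ^ (2 * m + 2)) * ternary_catalan k"
    let ?d = "binom (N - 3 * m - 3 * k - 3) ((real N - 3 * real m - 3 * real k - 4) / 2)"
    have "(\<Sum>n\<in>R (m, k). ?f (n, m, k)) = (\<Sum>n\<in>{3 * k + 1..N - 3 * m - 2}.
        ?c * (real ((n - 1) choose (3 * k)) * real ((N - n) choose (3 * m + 2))) * ?d)"
      unfolding R_def split
    proof (rule sum.cong[OF refl])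
      fix n assume "n \<in> {3 * k + 1..N - 3 * m - 2}"
      then have "multinom n k (2 * k + 1) (n - 3 * k - 1) / real n =
          ternary_catalan k * real ((n - 1) choose (3 * k))"
        by (intro multinom_div) auto
      moreover have "A / (real n * B) * M * C * D = A / B * (M / real n) * C * D" for A B M C D
        by simp
      ultimately show "3 ^ (3 * m + 2) / (real n * real N * 2 ^ (2 * m + 2))
            * multinom n k (2 * k + 1) (n - 3 * k - 1) * real ((N - n) choose (3 * m + 2)) * ?d =
          ?c * (real ((n - 1) choose (3 * k)) * real ((N - n) choose (3 * m + 2))) * ?d"
        by (simp only: mult.assoc)
    qed
    also have "\<dots> = triple_sum_term N m k"
      unfolding sum_distrib_left[symmetric] sum_distrib_right[symmetric] sum_choose_mult_choose_range[OF mk]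
        triple_sum_term_def ..
    finally show "(\<Sum>n\<in>R p. ?f (n, p)) = (case p of (m, k) \<Rightarrow> triple_sum_term N m k)"
      unfolding p by simp
  qed
  finally show ?thesis .
qed

text \<open>Substitute \<open>M = m + k + 1\<close> and use
  \<open>9/4 (27/4)^m = 3^(3m + 2) / 2^(2m + 2)\<close>.\<close>

lemma sum_triple_sum_terms:
  assumes "0 < N"
  shows "(\<Sum>M = 1..N div 3. \<Sum>k<M. real (N choose (3 * M)) / real N *
      (9 / 4 * (27 / 4) ^ (M - 1 - k) * ternary_catalan k) *
      binom (N - 3 * M) ((real N - 3 * real M - 1) / 2)) =
    (\<Sum>(m, k) \<in> {(m, k). 3 * m + 3 * k + 3 \<le> N}. triple_sum_term N m k)"
    (is "(\<Sum>M = 1..N div 3. \<Sum>k<M. ?g M k) = sum _ ?P")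
proof -
  have "(\<Sum>M = 1..N div 3. \<Sum>k<M. ?g M k) = (\<Sum>(M, k)\<in>Sigma {1..N div 3} lessThan. ?g M k)"
    by (rule sum.Sigma) auto
  also have "\<dots> = (\<Sum>(m, k) \<in> ?P. triple_sum_term N m k)"
  proof (rule sum.reindex_bij_witness[of _ "\<lambda>(m, k). (m + k + 1, k)" "\<lambda>(M, k). (M - 1 - k, k)"])
    fix x assume x: "x \<in> Sigma {1..N div 3} lessThan"
    obtain M k where Mk: "x = (M, k)" by (cases x)
    define m where "m = M - 1 - k"
    have k: "k < M" "3 * M \<le> N" using x Mk by auto
    then have M: "M = m + k + 1" by (simp add: m_def)
    have "(27 / 4 :: real) ^ m = 3 ^ (3 * m) / 2 ^ (2 * m)"
      by (simp add: power_divide power_mult)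
    then have "real (N choose (3 * M)) / real N * (9 / 4 * (27 / 4) ^ m * ternary_catalan k) *
        binom (N - 3 * M) ((real N - 3 * real M - 1) / 2) = triple_sum_term N m k"
      unfolding triple_sum_term_def M by (simp add: power_add algebra_simps)
    then show "(case (case x of (M, k) \<Rightarrow> (M - 1 - k, k)) of (m, k) \<Rightarrow> triple_sum_term N m k) =
        (case x of (M, k) \<Rightarrow> ?g M k)"
      unfolding Mk by (simp add: m_def)
  qed auto
  finally show ?thesis .
qed

theorem mainTheorem7:
  fixes N :: nat
  shows "real (walk_count (1, 0) N) =
      1 / real N * binom N ((real N - 1) / 2)
    + (\<Sum>n = 1..N div 3.
         3 ^ (3 * n - 1) / (real n * 2 ^ (2 * n))
         * real ((N - 1) choose (3 * n - 1))
         * binom (N - 3 * n) ((real N - 3 * real n - 1) / 2))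
    + (\<Sum>(n, m, k) \<in> triples N.
         3 ^ (3 * m + 2) / (real n * real N * 2 ^ (2 * m + 2))
         * multinom n k (2 * k + 1) (n - 3 * k - 1)
         * real ((N - n) choose (3 * m + 2))
         * binom (N - 3 * m - 3 * k - 3) ((real N - 3 * real m - 3 * real k - 4) / 2))"
proof (cases "N = 0")
  case True
  \<comment> \<open>A walk of length 0 has the origin as its only vertex. On the right-hand side the
    lower entry \<open>-1/2\<close> makes the first term 0.\<close>
  have "slit_walks 0 (1, 0) = {}" by (auto simp: slit_walks_def)
  moreover have "triples 0 = {}" by (auto simp: triples_def)
  ultimately show ?thesis using True by (simp add: walk_count_def)
next
  case False
  then have N: "0 < N" by simp
  let ?d = "\<lambda>M. binom (N - 3 * M) ((real N - 3 * real M - 1) / 2)"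
  let ?c = "\<lambda>M. real (N choose (3 * M)) / real N"
  have "real (walk_count (1, 0) N) = real N * real (walk_count (1, 0) N) / real N"
    using N by simp
  also have "\<dots> = (\<Sum>M\<le>N div 3. ?c M * level_weight M * ?d M)"
    unfolding walk_count_eq_sum_level_weights sum_divide_distrib by simp
  \<comment> \<open>The term \<open>M = 0\<close>, with \<open>level_weight\<close> 1, becomes the
    first summand of the formula.\<close>
  also have "{..N div 3} = insert 0 {1..N div 3}" by auto
  also have "(\<Sum>M\<in>insert 0 {1..N div 3}. ?c M * level_weight M * ?d M) =
      1 / real N * binom N ((real N - 1) / 2) + (\<Sum>M = 1..N div 3. ?c M * level_weight M * ?d M)"
    by simp
  also have "(\<Sum>M = 1..N div 3. ?c M * level_weight M * ?d M) =
      (\<Sum>M = 1..N div 3. ?c M * (27 / 4) ^ M * ?d M) +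
      (\<Sum>M = 1..N div 3. \<Sum>k<M. ?c M * (9 / 4 * (27 / 4) ^ (M - 1 - k) * ternary_catalan k) * ?d M)"
    unfolding sum.distrib[symmetric] sum_distrib_left[symmetric] sum_distrib_right[symmetric]
      level_weight_closed_form
    by (simp add: algebra_simps)
  also have "(\<Sum>M = 1..N div 3. ?c M * (27 / 4) ^ M * ?d M) =
      (\<Sum>n = 1..N div 3. 3 ^ (3 * n - 1) / (real n * 2 ^ (2 * n))
         * real ((N - 1) choose (3 * n - 1)) * ?d n)"
  proof (rule sum.cong[OF refl])
    fix n assume "n \<in> {1..N div 3}"
    then have n: "0 < n" by simp
    \<comment> \<open>Absorption produces the denominator \<open>3n\<close>, whose factor 3 lowers
      the exponent \<open>3n\<close> of the power of 3 by one.\<close>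
    have c: "?c n = real ((N - 1) choose (3 * n - 1)) / (3 * real n)"
      using choose_div_eq[OF N, of "3 * n"] n by simp
    have "(3::real) ^ (3 * n) = 3 * 3 ^ (3 * n - 1)"
      using n by (subst power_Suc[symmetric]) simp
    moreover have "(27 / 4 :: real) ^ n = 3 ^ (3 * n) / 2 ^ (2 * n)"
      by (simp add: power_divide power_mult)
    ultimately have "(27 / 4 :: real) ^ n = 3 * 3 ^ (3 * n - 1) / 2 ^ (2 * n)" by simp
    then show "?c n * (27 / 4) ^ n * ?d n = 3 ^ (3 * n - 1) / (real n * 2 ^ (2 * n))
         * real ((N - 1) choose (3 * n - 1)) * ?d n"
      unfolding c by simp
  qed
  finally show ?thesis
    unfolding sum_triples sum_triple_sum_terms[OF N] by (simp only: add.assoc)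
qed

end
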